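(* Let $K$ be a field, $S=K[x_1,\ldots,x_n]$, and let $I\subset S$ be a monomial ideal minimally generated by $m$ monomials. If $\operatorname{slength}(I)=m\leq 3$, then $I$ has linear quotients.
   Context: Let $M$ be a finitely generated $\mathbb Z^n$-graded $S$-module, $S=K[x_1,\ldots,x_n]$. A Stanley decomposition of $M$ is a finite direct sum of $K$-vector spaces $\mathcal D: M=\bigoplus_{i=1}^r m_iK[Z_i]$, where each $m_i\in M$ is homogeneous, $Z_i\subset\{x_1,\ldots,x_n\}$, and $m_iK[Z_i]$ is a free $K[Z_i]$-module. Its length is $\operatorname{slength}(\mathcal D)=r$, and the Stanley length of $M$ is $\operatorname{slength}(M)=\min\{\operatorname{slength}(\mathcal D):\mathcal D\text{ is a Stanley decomposition of }M\}$. A monomial ideal $I$ has linear quotients if its minimal monomial generators can be ordered as $u_1,u_2,\ldots,u_m$ so that for every $2\leq j\leq m$ the ideal $(u_1,\ldots,u_{j-1}):u_j$ is generated by a subset of the variables. *)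

theory Defs
  imports Main "HOL-Library.Poly_Mapping" "HOL-Library.FuncSet" "HOL-Library.Extended_Nat"
begin

text \<open>The polynomial ring \<open>K[x\<^sub>i | i \<in> 'n]\<close>; a monomial is given by its exponent vector.\<close>

type_synonym ('n, 'k) mpoly = "('n \<Rightarrow>\<^sub>0 nat) \<Rightarrow>\<^sub>0 'k"

interpretation ideal: module "(*) :: 'a::comm_ring_1 \<Rightarrow> 'a \<Rightarrow> 'a"
  by unfold_locales (simp_all add: algebra_simps)

definition mon :: "('n \<Rightarrow>\<^sub>0 nat) \<Rightarrow> ('n, 'k::comm_ring_1) mpoly" where
  "mon u = Poly_Mapping.single u 1"

definition var :: "'n \<Rightarrow> ('n, 'k::comm_ring_1) mpoly" where
  "var i = mon (Poly_Mapping.single i 1)"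

definition polys_in :: "'n set \<Rightarrow> ('n, 'k::comm_ring_1) mpoly set" where
  "polys_in Z = {f. \<forall>u \<in> Poly_Mapping.keys f. Poly_Mapping.keys u \<subseteq> Z}"


subsection \<open>Stanley decompositions\<close>

text \<open>A \<open>\<int>\<^sup>n\<close>-graded module is given by its scalar multiplication \<open>scale\<close>, the family \<open>grade\<close> of
  the homogeneous components of the ambient group, and its set \<open>M\<close> of elements.\<close>

definition homogeneous :: "(('n \<Rightarrow> int) \<Rightarrow> 'm set) \<Rightarrow> 'm \<Rightarrow> bool" where
  "homogeneous grade x \<longleftrightarrow> (\<exists>a. x \<in> grade a)"

definition stanley_space ::
  "(('n, 'k::field) mpoly \<Rightarrow> 'm \<Rightarrow> 'm::ab_group_add) \<Rightarrow> 'm \<Rightarrow> 'n set \<Rightarrow> 'm set" where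
  "stanley_space scale x Z = (\<lambda>f. scale f x) ` polys_in Z"

text \<open>The condition on \<open>f\<close> says that \<open>x K[Z]\<close> is free over \<open>K[Z]\<close> with basis
  \<open>x\<close>; in particular \<open>x \<noteq> 0\<close>. The last clause says that \<open>M\<close> is the internal direct sum of the
  Stanley spaces.\<close>

definition stanley_decomposition ::
  "(('n, 'k::field) mpoly \<Rightarrow> 'm \<Rightarrow> 'm::ab_group_add) \<Rightarrow> (('n \<Rightarrow> int) \<Rightarrow> 'm set) \<Rightarrow> 'm set
    \<Rightarrow> ('m \<times> 'n set) list \<Rightarrow> bool" where
  "stanley_decomposition scale grade M D \<longleftrightarrow>
     (\<forall>(x, Z) \<in> set D. (x \<in> M \<and> homogeneous grade x) \<and>
        (\<forall>f \<in> polys_in Z. scale f x = 0 \<longrightarrow> f = 0)) \<and>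
     bij_betw (\<lambda>v. \<Sum>i<length D. v i)
       (\<Pi>\<^sub>E i\<in>{..<length D}. stanley_space scale (fst (D ! i)) (snd (D ! i))) M"

text \<open>The infimum is a minimum as soon as \<open>M\<close> has a Stanley decomposition, which is the case for
  every finitely generated graded module; otherwise it is \<open>\<infinity>\<close>.\<close>

definition slength ::
  "(('n, 'k::field) mpoly \<Rightarrow> 'm \<Rightarrow> 'm::ab_group_add) \<Rightarrow> (('n \<Rightarrow> int) \<Rightarrow> 'm set) \<Rightarrow> 'm set
    \<Rightarrow> enat" where
  "slength scale grade M = (INF D \<in> {D. stanley_decomposition scale grade M D}. enat (length D))"

text \<open>The component of multidegree \<open>a\<close> of the polynomial ring; it is \<open>{0}\<close> if \<open>a\<close> has a negative
  entry.\<close>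

definition multigrade :: "('n \<Rightarrow> int) \<Rightarrow> ('n, 'k::field) mpoly set" where
  "multigrade a =
     {f. \<forall>u \<in> Poly_Mapping.keys f. \<forall>i. int (Poly_Mapping.lookup u i) = a i}"


subsection \<open>Monomial ideals and linear quotients\<close>

definition monomial_ideal :: "('n, 'k::field) mpoly set \<Rightarrow> bool" where
  "monomial_ideal I \<longleftrightarrow> (\<exists>A. I = ideal.span (mon ` A))"

definition minimal_monomial_generators ::
  "('n, 'k::field) mpoly set \<Rightarrow> ('n \<Rightarrow>\<^sub>0 nat) set \<Rightarrow> bool" where
  "minimal_monomial_generators I A \<longleftrightarrow>
     ideal.span (mon ` A) = I \<and> (\<forall>B. B \<subset> A \<longrightarrow> ideal.span (mon ` B) \<noteq> I)"

definition colon :: "'a::comm_ring_1 set \<Rightarrow> 'a \<Rightarrow> 'a set" where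
  "colon J g = {f. f * g \<in> J}"

text \<open>The generators are indexed from 0 here, so \<open>set (take j us)\<close> consists of the generators
  preceding \<open>us ! j\<close>.\<close>

definition linear_quotients :: "('n, 'k::field) mpoly set \<Rightarrow> bool" where
  "linear_quotients I \<longleftrightarrow>
     (\<exists>us. distinct us \<and> minimal_monomial_generators I (set us) \<and>
        (\<forall>j. 1 \<le> j \<and> j < length us \<longrightarrow>
           (\<exists>V. colon (ideal.span (mon ` set (take j us))) (mon (us ! j) :: ('n, 'k) mpoly) =
                ideal.span (var ` V))))"

end

theory Submission
  imports Defs
begin

text \<open>
  A Stanley decomposition of length \<open>card A\<close> partitions the monomials of \<open>I\<close> into cones
  \<open>u + \<nat>\<^sup>Z\<close>, one with vertex \<open>u\<close> for every minimal generator \<open>u\<close>. Write \<open>p \<rightarrow> q\<close> if some monomial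
  of the cone \<open>p\<close> divides a monomial of the cone \<open>q\<close>. If the cones can be ordered without arrows
  pointing to a later cone, then the colon ideal at the cone \<open>u + \<nat>\<^sup>Z\<close> is generated by the
  variables outside \<open>Z\<close>. A cone containing a monomial that is large in every variable has
  \<open>Z\<close> equal to the set of all variables, so no arrow leaves it. Two disjoint cones never have arrows
  in both directions, since otherwise the least common multiple of their vertices would lie in
  both. So for at most three cones, the full cone followed by the others in a suitable order
  has no forward arrows.
\<close>

section \<open>Monomial ideals\<close>

abbreviation mon_dvd :: "('n \<Rightarrow>\<^sub>0 nat) \<Rightarrow> ('n \<Rightarrow>\<^sub>0 nat) \<Rightarrow> bool" where
  "mon_dvd u v \<equiv> \<forall>i. Poly_Mapping.lookup u i \<le> Poly_Mapping.lookup v i"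

lemma mon_dvd_trans: "mon_dvd u v \<Longrightarrow> mon_dvd v w \<Longrightarrow> mon_dvd u w"
  using order_trans by blast

lemma mon_dvd_antisym: "mon_dvd u v \<Longrightarrow> mon_dvd v u \<Longrightarrow> u = v"
  by (intro poly_mapping_eqI antisym) auto

text \<open>Sets of this kind are exactly the sets of exponents of the monomials in a monomial
  ideal.\<close>

definition mon_up_closed :: "('n \<Rightarrow>\<^sub>0 nat) set \<Rightarrow> bool" where
  "mon_up_closed E \<longleftrightarrow> (\<forall>v\<in>E. \<forall>w. mon_dvd v w \<longrightarrow> w \<in> E)"

lemma mon_up_closedD: "mon_up_closed E \<Longrightarrow> v \<in> E \<Longrightarrow> mon_dvd v w \<Longrightarrow> w \<in> E"
  unfolding mon_up_closed_def by blast

lemma diff_add_mon_dvd: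
  assumes "mon_dvd u v"
  shows "(v - u) + u = v"
  using assms by (intro poly_mapping_eqI) (simp add: lookup_add lookup_minus)

lemma single_mon_dvd_iff:
  "mon_dvd (Poly_Mapping.single i 1) t \<longleftrightarrow> i \<in> Poly_Mapping.keys t"
  by (auto simp: lookup_single in_keys_iff when_def Suc_le_eq)

lemma lookup_times_mon:
  fixes f :: "('n, 'k::comm_ring_1) mpoly"
  shows "Poly_Mapping.lookup (f * mon u) (t + u) = Poly_Mapping.lookup f t"
proof -
  \<comment> \<open>Only \<open>q = u\<close> contributes to the inner convolution sum, and
    cancelling \<open>u\<close> in \<open>t + u = l + u\<close> leaves the single index
    \<open>l = t\<close>.\<close>
  have "(\<Sum>q. Poly_Mapping.lookup (mon u :: ('n, 'k) mpoly) q when t + u = l + q)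
      = (1 when t = l)" for l
  proof -
    have "(\<Sum>q. Poly_Mapping.lookup (mon u :: ('n, 'k) mpoly) q when t + u = l + q)
        = (\<Sum>q. (1 when t + u = l + q) when u = q)"
      by (rule Sum_any.cong) (auto simp: mon_def lookup_single when_def)
    then show ?thesis by simp
  qed
  then show ?thesis by (simp add: lookup_mult mult_when)
qed

lemma keys_times_mon:
  fixes f :: "('n, 'k::comm_ring_1) mpoly"
  shows "Poly_Mapping.keys (f * mon u) = (\<lambda>t. t + u) ` Poly_Mapping.keys f"
proof
  show "Poly_Mapping.keys (f * mon u) \<subseteq> (\<lambda>t. t + u) ` Poly_Mapping.keys f"
    using keys_mult[of f "mon u"] by (auto simp: mon_def)
qed (auto simp: in_keys_iff lookup_times_mon)

text \<open>Reduces ideal membership to divisibility of exponent vectors. The right-hand side is an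
  ideal containing the generators; conversely, each term of one of its elements is a multiple of a
  generator.\<close>

lemma span_mon:
  "ideal.span (mon ` B) =
    {f :: ('n, 'k::comm_ring_1) mpoly. \<forall>w \<in> Poly_Mapping.keys f. \<exists>b\<in>B. mon_dvd b w}"
    (is "_ = ?R")
proof
  have "ideal.subspace ?R"
  proof (rule ideal.subspaceI)
    fix x y :: "('n, 'k) mpoly"
    assume "x \<in> ?R" "y \<in> ?R"
    then show "x + y \<in> ?R" using Poly_Mapping.keys_add[of x y] by blast
  next
    fix c x :: "('n, 'k) mpoly"
    assume x: "x \<in> ?R"
    have "\<exists>b\<in>B. mon_dvd b w" if "w \<in> Poly_Mapping.keys (c * x)" for w
    proof -
      obtain s t where "w = s + t" "t \<in> Poly_Mapping.keys x"
        using \<open>w \<in> Poly_Mapping.keys (c * x)\<close> keys_mult[of c x] by blast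
      then show ?thesis using x by (force simp: lookup_add intro: trans_le_add2)
    qed
    then show "c * x \<in> ?R" by blast
  qed simp
  moreover have "mon ` B \<subseteq> ?R" by (auto simp: mon_def)
  ultimately show "ideal.span (mon ` B) \<subseteq> ?R" by (rule ideal.span_minimal[rotated])
  show "?R \<subseteq> ideal.span (mon ` B)"
  proof
    fix f :: "('n, 'k) mpoly"
    assume f: "f \<in> ?R"
    have "Poly_Mapping.single w c \<in> ideal.span (mon ` B)"
      if w: "w \<in> Poly_Mapping.keys f" for w and c :: 'k
    proof -
      obtain b where b: "b \<in> B" "mon_dvd b w" using f w by blast
      have "Poly_Mapping.single w c = Poly_Mapping.single (w - b) c * mon b"
        using diff_add_mon_dvd[OF b(2)] by (simp add: mon_def mult_single)
      then show ?thesis using b(1) by (simp add: ideal.span_scale ideal.span_base)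
    qed
    then have "(\<Sum>w\<in>Poly_Mapping.keys f. Poly_Mapping.single w (Poly_Mapping.lookup f w))
        \<in> ideal.span (mon ` B)"
      by (intro ideal.span_sum) auto
    also have "(\<Sum>w\<in>Poly_Mapping.keys f. Poly_Mapping.single w (Poly_Mapping.lookup f w)) = f"
      by (rule poly_mapping_eqI)
        (auto simp: lookup_sum lookup_single when_def in_keys_iff sum.delta)
    finally show "f \<in> ideal.span (mon ` B)" .
  qed
qed

lemma mon_in_span_iff:
  "(mon w :: ('n, 'k::comm_ring_1) mpoly) \<in> ideal.span (mon ` B) \<longleftrightarrow> (\<exists>b\<in>B. mon_dvd b w)"
  unfolding span_mon by (simp add: mon_def)

lemma span_mon_eqI:
  assumes "\<And>w. (\<exists>b\<in>B. mon_dvd b w) \<longleftrightarrow> (\<exists>c\<in>C. mon_dvd c w)"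
  shows "ideal.span (mon ` B) = (ideal.span (mon ` C) :: ('n, 'k::comm_ring_1) mpoly set)"
  unfolding span_mon using assms by simp

text \<open>Otherwise \<open>b\<close> could be dropped without changing the ideal, since each of
  its multiples is already a multiple of \<open>a\<close>.\<close>

lemma minimal_monomial_generators_antichain:
  fixes I :: "('n, 'k::field) mpoly set"
  assumes "minimal_monomial_generators I A" "a \<in> A" "b \<in> A" "mon_dvd a b"
  shows "a = b"
proof (rule ccontr)
  assume "a \<noteq> b"
  have "ideal.span (mon ` (A - {b})) = (ideal.span (mon ` A) :: ('n, 'k) mpoly set)"
  proof (rule span_mon_eqI)
    fix w
    show "(\<exists>c\<in>A - {b}. mon_dvd c w) \<longleftrightarrow> (\<exists>c\<in>A. mon_dvd c w)"
      using assms(2,4) \<open>a \<noteq> b\<close> mon_dvd_trans[of a b w] by blast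
  qed
  moreover have "A - {b} \<subset> A" using assms(3) by blast
  ultimately show False using assms(1) unfolding minimal_monomial_generators_def by blast
qed

text \<open>Multiplication by \<open>mon u\<close> only shifts the keys of a polynomial by
  \<open>u\<close>, so the colon ideal is determined by the monomials \<open>t\<close> with
  \<open>t + u\<close> in the ideal. By assumption these are the \<open>t\<close> divisible by a
  variable outside \<open>Z\<close>.\<close>

lemma colon_span_mon_eq_span_var:
  assumes "\<And>t. (\<exists>b\<in>B. mon_dvd b (t + u)) \<longleftrightarrow> \<not> Poly_Mapping.keys t \<subseteq> Z"
  shows "colon (ideal.span (mon ` B)) (mon u) =
    (ideal.span (var ` (- Z)) :: ('n, 'k::comm_ring_1) mpoly set)"
proof -
  have "(var ` (- Z) :: ('n, 'k) mpoly set) = mon ` (\<lambda>i. Poly_Mapping.single i 1) ` (- Z)"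
    by (auto simp: var_def)
  then show ?thesis
    by (auto simp: span_mon colon_def keys_times_mon assms single_mon_dvd_iff
        simp del: One_nat_def)
qed


section \<open>Cones of monomials\<close>

text \<open>The exponents of the monomials in the Stanley space with generator
  \<open>mon (fst p)\<close> and variable set \<open>snd p\<close>.\<close>

definition cone :: "('n \<Rightarrow>\<^sub>0 nat) \<times> 'n set \<Rightarrow> ('n \<Rightarrow>\<^sub>0 nat) set" where
  "cone p = {fst p + t | t. Poly_Mapping.keys t \<subseteq> snd p}"

lemma cone_iff:
  "w \<in> cone p \<longleftrightarrow> mon_dvd (fst p) w \<and>
    (\<forall>i. i \<notin> snd p \<longrightarrow> Poly_Mapping.lookup w i = Poly_Mapping.lookup (fst p) i)"
    (is "_ \<longleftrightarrow> ?R")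
proof
  assume "w \<in> cone p"
  then show ?R by (auto simp: cone_def lookup_add in_keys_iff)
next
  assume R: ?R
  then have "w = fst p + (w - fst p)"
    using diff_add_mon_dvd[of "fst p" w] by (simp add: add.commute)
  moreover have "Poly_Mapping.keys (w - fst p) \<subseteq> snd p"
    using R by (auto simp: in_keys_iff lookup_minus)
  ultimately show "w \<in> cone p" unfolding cone_def by blast
qed

lemma vertex_in_cone: "fst p \<in> cone p"
  by (simp add: cone_iff)

lemma add_in_cone_iff: "t + fst p \<in> cone p \<longleftrightarrow> Poly_Mapping.keys t \<subseteq> snd p"
  by (auto simp: cone_iff lookup_add in_keys_iff)

text \<open>It suffices to test the vertex of \<open>p\<close>, because it divides every monomial of
  \<open>cone p\<close>.\<close>

definition cone_arrow :: "('n \<Rightarrow>\<^sub>0 nat) \<times> 'n set \<Rightarrow> ('n \<Rightarrow>\<^sub>0 nat) \<times> 'n set \<Rightarrow> bool" where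
  "cone_arrow p q \<longleftrightarrow> (\<exists>w \<in> cone q. mon_dvd (fst p) w)"

lemma cone_arrow_lookup_le:
  assumes "cone_arrow p q" "i \<notin> snd q"
  shows "Poly_Mapping.lookup (fst p) i \<le> Poly_Mapping.lookup (fst q) i"
proof -
  obtain w where w: "w \<in> cone q" "mon_dvd (fst p) w" using assms(1) by (auto simp: cone_arrow_def)
  have "Poly_Mapping.lookup w i = Poly_Mapping.lookup (fst q) i"
    using w(1) assms(2) by (simp add: cone_iff)
  then show ?thesis using spec[OF w(2), of i] by simp
qed

lemma cone_arrow_antisym:
  assumes "cone_arrow p q" "cone_arrow q p"
  shows "cone p \<inter> cone q \<noteq> {}"
proof -
  \<comment> \<open>Subtraction of exponents is truncated at 0, so \<open>w\<close> is the
    coordinatewise maximum, that is, the least common multiple of the two vertices.\<close>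
  define w where "w = fst p + (fst q - fst p)"
  have w: "Poly_Mapping.lookup w i =
      max (Poly_Mapping.lookup (fst p) i) (Poly_Mapping.lookup (fst q) i)" for i
    by (simp add: w_def lookup_add lookup_minus max_def)
  \<comment> \<open>At a coordinate outside \<open>snd p\<close> the arrow from \<open>q\<close> to
    \<open>p\<close> shows that the maximum is attained by \<open>fst p\<close>; the case of
    \<open>snd q\<close> is symmetric.\<close>
  have "w \<in> cone p \<inter> cone q"
    using cone_arrow_lookup_le[OF assms(1)] cone_arrow_lookup_le[OF assms(2)]
    by (auto simp: cone_iff w max_def intro: antisym)
  then show ?thesis by blast
qed

text \<open>A full cone contains all multiples of its vertex, so the monomial witnessing an arrow
  would lie in both cones.\<close>

lemma full_cone_no_arrow:
  assumes "snd p = UNIV" "cone p \<inter> cone q = {}"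
  shows "\<not> cone_arrow p q"
  using assms by (auto simp: cone_arrow_def cone_iff)

section \<open>Ordering at most three cones\<close>

lemma ex_full_cone:
  fixes P :: "(('n::finite \<Rightarrow>\<^sub>0 nat) \<times> 'n set) set"
  assumes "finite P" "P \<noteq> {}"
    and up: "mon_up_closed (\<Union> (cone ` P))"
  obtains p where "p \<in> P" "snd p = UNIV"
proof -
  \<comment> \<open>The sum of all vertices plus one in every coordinate: \<open>w\<close> strictly
    exceeds every vertex everywhere, so whichever cone contains it can have no fixed
    coordinate.\<close>
  define w where "w = (\<Sum>p\<in>P. fst p) + (\<Sum>i\<in>UNIV. Poly_Mapping.single (i::'n) 1)"
  have w: "Poly_Mapping.lookup w i = Suc (\<Sum>p\<in>P. Poly_Mapping.lookup (fst p) i)" for i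
    by (simp add: w_def lookup_add lookup_sum lookup_single when_def)
  have le: "Poly_Mapping.lookup (fst p) i < Poly_Mapping.lookup w i" if "p \<in> P" for p i
    using member_le_sum[of p P "\<lambda>p. Poly_Mapping.lookup (fst p) i"] that assms(1)
    by (simp add: w)
  obtain q where "q \<in> P" using assms(2) by blast
  then have "fst q \<in> \<Union> (cone ` P)" using vertex_in_cone by blast
  then have "w \<in> \<Union> (cone ` P)"
    using mon_up_closedD[OF up] le[OF \<open>q \<in> P\<close>] by (simp add: less_imp_le)
  then obtain p where p: "p \<in> P" "w \<in> cone p" by blast
  then have "snd p = UNIV"
    using le[OF p(1)] by (auto simp: cone_iff set_eq_iff) (metis less_irrefl)
  with p(1) show ?thesis by (rule that)
qed

lemma ex_cone_order:
  fixes P :: "(('n::finite \<Rightarrow>\<^sub>0 nat) \<times> 'n set) set"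
  assumes "finite P" "card P \<le> 3"
    and up: "mon_up_closed (\<Union> (cone ` P))"
    and disj: "pairwise (\<lambda>p q. cone p \<inter> cone q = {}) P"
  obtains ps where "set ps = P" "distinct ps" "sorted_wrt (\<lambda>p q. \<not> cone_arrow p q) ps"
proof (cases "P = {}")
  case True
  then show ?thesis using that[of "[]"] by simp
next
  case False
  obtain p where p: "p \<in> P" "snd p = UNIV"
    using ex_full_cone[OF assms(1) False up] .
  \<comment> \<open>The bound 3 enters here: with the full cone placed first, at most one pair of
    cones remains to be ordered.\<close>
  have "card (P - {p}) \<le> 2" using assms(1,2) p(1) by simp
  then consider "card (P - {p}) = 0" | "card (P - {p}) = 1" | "card (P - {p}) = 2" by linarith
  then obtain qs where qs: "set qs = P - {p}" "distinct qs"
    "sorted_wrt (\<lambda>p q. \<not> cone_arrow p q) qs"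
  proof cases
    case 1
    then show ?thesis using that[of "[]"] assms(1) by simp
  next
    case 2
    then obtain q where "P - {p} = {q}" by (auto simp: card_1_singleton_iff)
    then show ?thesis using that[of "[q]"] by simp
  next
    case 3
    then obtain q r where qr: "P - {p} = {q, r}" "q \<noteq> r" by (auto simp: card_2_iff)
    then have "cone q \<inter> cone r = {}" using pairwiseD[OF disj, of q r] by blast
    then have "\<not> cone_arrow q r \<or> \<not> cone_arrow r q" using cone_arrow_antisym by blast
    then show ?thesis
      using that[of "[q, r]"] that[of "[r, q]"] qr by (auto simp: insert_commute)
  qed
  show ?thesis
  proof (rule that[of "p # qs"])
    show "sorted_wrt (\<lambda>p q. \<not> cone_arrow p q) (p # qs)"
      using qs(1,3) full_cone_no_arrow[OF p(2)] pairwiseD[OF disj p(1)] by auto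
  qed (use qs p in auto)
qed

section \<open>Colon ideals along an order without forward arrows\<close>

lemma colon_of_cone_order:
  fixes ps :: "(('n \<Rightarrow>\<^sub>0 nat) \<times> 'n set) list"
  assumes "sorted_wrt (\<lambda>p q. \<not> cone_arrow p q) ps"
    and up: "mon_up_closed (\<Union> (cone ` set ps))"
    and j: "j < length ps"
  shows "colon (ideal.span (mon ` set (take j (map fst ps)))) (mon (map fst ps ! j)) =
    (ideal.span (var ` (- snd (ps ! j))) :: ('n, 'k::comm_ring_1) mpoly set)"
proof (rule colon_span_mon_eq_span_var)
  fix t
  define q where "q = ps ! j"
  define w where "w = t + fst q"
  have q: "q \<in> set ps" using j by (simp add: q_def)
  have dvd: "mon_dvd (fst q) w" by (simp add: w_def lookup_add)
  have arrow: "\<not> cone_arrow (ps ! i) (ps ! k)" if "i < k" "k < length ps" for i k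
    using assms(1) that by (simp add: sorted_wrt_iff_nth_less)
  have take_j: "(\<exists>b\<in>set (take j (map fst ps)). mon_dvd b w) \<longleftrightarrow>
      (\<exists>i<j. mon_dvd (fst (ps ! i)) w)"
    using j by (auto simp: in_set_conv_nth Bex_def)
  \<comment> \<open>A multiple \<open>w\<close> of the vertex of \<open>q\<close> lies in some cone.
    That cone cannot come after \<open>q\<close>, as this would give a forward arrow. So
    \<open>w\<close> lies in \<open>cone q\<close> or in an earlier cone, and the absence of forward
    arrows makes \<open>cone q\<close> exclude multiples of earlier vertices.\<close>
  have "(\<exists>i<j. mon_dvd (fst (ps ! i)) w) \<longleftrightarrow> w \<notin> cone q"
  proof
    assume "\<exists>i<j. mon_dvd (fst (ps ! i)) w"
    then show "w \<notin> cone q" using arrow[OF _ j] by (auto simp: q_def cone_arrow_def)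
  next
    assume w: "w \<notin> cone q"
    have "fst q \<in> \<Union> (cone ` set ps)" using vertex_in_cone q by blast
    then have "w \<in> \<Union> (cone ` set ps)" by (rule mon_up_closedD[OF up _ dvd])
    then obtain k where k: "k < length ps" "w \<in> cone (ps ! k)"
      by (auto simp: in_set_conv_nth)
    then have "cone_arrow q (ps ! k)" using dvd by (auto simp: cone_arrow_def)
    then have "\<not> j < k" using arrow k(1) by (auto simp: q_def)
    moreover have "k \<noteq> j" using k(2) w by (auto simp: q_def)
    ultimately have "k < j" by simp
    then show "\<exists>i<j. mon_dvd (fst (ps ! i)) w" using k(2) by (auto simp: cone_iff)
  qed
  then show "(\<exists>b\<in>set (take j (map fst ps)). mon_dvd b (t + map fst ps ! j)) \<longleftrightarrow>
      \<not> Poly_Mapping.keys t \<subseteq> snd (ps ! j)"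
    using take_j j by (simp add: w_def q_def add_in_cone_iff)
qed


section \<open>Stanley decompositions as partitions into cones\<close>

text \<open>The multidegree fixes every exponent, so a nonzero homogeneous polynomial has exactly
  one monomial.\<close>

lemma homogeneous_multigradeE:
  fixes x :: "('n, 'k::field) mpoly"
  assumes "homogeneous multigrade x" "x \<noteq> 0"
  obtains u c where "x = Poly_Mapping.single u c" "c \<noteq> 0"
proof -
  obtain a where a: "\<And>u i. u \<in> Poly_Mapping.keys x \<Longrightarrow> int (Poly_Mapping.lookup u i) = a i"
    using assms(1) by (auto simp: homogeneous_def multigrade_def)
  obtain u where u: "u \<in> Poly_Mapping.keys x"
    using assms(2) poly_mapping_eqI[of x 0] by (auto simp: in_keys_iff)
  have uniq: "v = u" if "v \<in> Poly_Mapping.keys x" for v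
    by (rule poly_mapping_eqI) (metis a that u of_nat_eq_iff)
  have "x = Poly_Mapping.single u (Poly_Mapping.lookup x u)"
    by (rule poly_mapping_eqI) (metis in_keys_iff lookup_single_eq lookup_single_not_eq uniq)
  moreover have "Poly_Mapping.lookup x u \<noteq> 0" using u by (simp add: in_keys_iff)
  ultimately show ?thesis by (rule that)
qed

lemma keys_stanley_space:
  fixes g :: "('n, 'k::field) mpoly"
  assumes "g \<in> stanley_space (*) (Poly_Mapping.single u c) Z"
  shows "Poly_Mapping.keys g \<subseteq> cone (u, Z)"
proof
  fix w assume "w \<in> Poly_Mapping.keys g"
  moreover obtain f where f: "f \<in> polys_in Z" "g = f * Poly_Mapping.single u c"
    using assms by (auto simp: stanley_space_def)
  ultimately obtain t where "t \<in> Poly_Mapping.keys f" "w = t + u"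
    using keys_mult[of f "Poly_Mapping.single u c"] by (auto split: if_splits)
  then show "w \<in> cone (u, Z)" using f(1) add_in_cone_iff[of t "(u, Z)"] by (auto simp: polys_in_def)
qed

lemma mon_in_stanley_space:
  assumes "w \<in> cone (u, Z)" "c \<noteq> 0"
  shows "(mon w :: ('n, 'k::field) mpoly) \<in> stanley_space (*) (Poly_Mapping.single u c) Z"
proof -
  obtain t where t: "w = u + t" "Poly_Mapping.keys t \<subseteq> Z" using assms(1) by (auto simp: cone_def)
  have "mon w = Poly_Mapping.single t (inverse c) * Poly_Mapping.single u c"
    using assms(2) by (simp add: mon_def mult_single t add.commute)
  moreover have "Poly_Mapping.single t (inverse c) \<in> polys_in Z"
    using t(2) by (auto simp: polys_in_def)
  ultimately show ?thesis unfolding stanley_space_def by blast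
qed

lemma zero_in_stanley_space: "(0 :: ('n, 'k::field) mpoly) \<in> stanley_space (*) x Z"
  unfolding stanley_space_def by (rule image_eqI[of _ _ 0]) (simp_all add: polys_in_def)

text \<open>Surjectivity of the summation map makes the cones cover the monomials of
  \<open>I\<close>; injectivity makes them disjoint.\<close>

lemma stanley_decomposition_cones:
  fixes I :: "('n, 'k::field) mpoly set"
  assumes "stanley_decomposition (*) multigrade I D"
  obtains ps where "length ps = length D" "\<Union> (cone ` set ps) = {w. mon w \<in> I}"
    "\<And>i j. i < length ps \<Longrightarrow> j < length ps \<Longrightarrow> i \<noteq> j \<Longrightarrow> cone (ps ! i) \<inter> cone (ps ! j) = {}"
proof -
  define X where "X i = stanley_space (*) (fst (D ! i)) (snd (D ! i))" for i
  have bij: "bij_betw (\<lambda>v. \<Sum>i<length D. v i) (\<Pi>\<^sub>E i\<in>{..<length D}. X i) I"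
    using assms unfolding stanley_decomposition_def X_def by blast
  have "\<exists>u c. fst (D ! i) = Poly_Mapping.single u c \<and> c \<noteq> 0" if "i < length D" for i
  proof -
    have D: "homogeneous multigrade (fst (D ! i))"
      "\<And>f. f \<in> polys_in (snd (D ! i)) \<Longrightarrow> f * fst (D ! i) = 0 \<Longrightarrow> f = 0"
      using assms nth_mem[OF that] unfolding stanley_decomposition_def
      by (auto simp: case_prod_beta)
    \<comment> \<open>Freeness tested on the polynomial 1 shows that the generator is
      nonzero.\<close>
    have "(1 :: ('n, 'k) mpoly) \<in> polys_in (snd (D ! i))" by (simp add: polys_in_def)
    then have "fst (D ! i) \<noteq> 0" using D(2)[of 1] by auto
    then show ?thesis using homogeneous_multigradeE[OF D(1)] by metis
  qed
  then obtain u c where uc: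
    "\<And>i. i < length D \<Longrightarrow> fst (D ! i) = Poly_Mapping.single (u i) (c i) \<and> c i \<noteq> 0"
    by metis
  define ps where "ps = map (\<lambda>i. (u i, snd (D ! i))) [0..<length D]"
  have len: "length ps = length D" by (simp add: ps_def)
  have keys_X: "Poly_Mapping.keys g \<subseteq> cone (ps ! i)" if "i < length D" "g \<in> X i" for i g
    using that uc[OF that(1)] keys_stanley_space[of g "u i" "c i"] by (simp add: X_def ps_def)
  have mon_X: "mon w \<in> X i" if "i < length D" "w \<in> cone (ps ! i)" for i w
    using that uc[OF that(1)] mon_in_stanley_space[of w "u i" _ "c i"] by (simp add: X_def ps_def)
  \<comment> \<open>The family representing \<open>mon w\<close> by its \<open>i\<close>-th
    component alone. The value \<open>undefined\<close> beyond the index range is what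
    \<open>\<Pi>\<^sub>E\<close> demands.\<close>
  define e :: "nat \<Rightarrow> ('n \<Rightarrow>\<^sub>0 nat) \<Rightarrow> nat \<Rightarrow> ('n, 'k) mpoly" where
    "e i w = (\<lambda>j. if j < length D then if j = i then mon w else 0 else undefined)" for i w
  have e: "e i w \<in> (\<Pi>\<^sub>E i\<in>{..<length D}. X i)" if "i < length D" "w \<in> cone (ps ! i)" for i w
    using mon_X[OF that] by (auto simp: e_def X_def zero_in_stanley_space split: if_splits)
  have sum_e: "(\<Sum>j<length D. e i w j) = mon w" if "i < length D" for i w
  proof -
    have "(\<Sum>j<length D. e i w j) = (\<Sum>j<length D. if j = i then mon w else 0)"
      by (rule sum.cong) (auto simp: e_def)
    then show ?thesis using that by simp
  qed
  show ?thesis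
  proof (rule that[OF len])
    show "\<Union> (cone ` set ps) = {w. mon w \<in> I}"
    proof (intro equalityI subsetI)
      fix w assume "w \<in> \<Union> (cone ` set ps)"
      then obtain i where i: "i < length D" "w \<in> cone (ps ! i)"
        by (auto simp: in_set_conv_nth len)
      then show "w \<in> {w. mon w \<in> I}"
        using bij_betw_apply[OF bij e[OF i]] sum_e[OF i(1)] by simp
    next
      fix w assume "w \<in> {w. mon w \<in> I}"
      then obtain v where v: "v \<in> (\<Pi>\<^sub>E i\<in>{..<length D}. X i)" "mon w = (\<Sum>i<length D. v i)"
        using bij_betw_imp_surj_on[OF bij] by blast
      have "w \<in> Poly_Mapping.keys (\<Sum>i<length D. v i)" by (simp add: v(2)[symmetric] mon_def)
      then obtain i where i: "i < length D" "w \<in> Poly_Mapping.keys (v i)"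
        by (auto simp: in_keys_iff lookup_sum elim: sum.not_neutral_contains_not_neutral)
      then have "w \<in> cone (ps ! i)" using keys_X[OF i(1), of "v i"] v(1) by auto
      then show "w \<in> \<Union> (cone ` set ps)" using i(1) len by auto
    qed
  next
    fix i j assume "i < length ps" "j < length ps" and ij: "i \<noteq> j"
    then have i: "i < length D" and j: "j < length D" by (simp_all add: len)
    show "cone (ps ! i) \<inter> cone (ps ! j) = {}"
    proof (rule ccontr)
      assume "cone (ps ! i) \<inter> cone (ps ! j) \<noteq> {}"
      then obtain w where w: "w \<in> cone (ps ! i)" "w \<in> cone (ps ! j)" by blast
      \<comment> \<open>A monomial in two cones would have two representations as a sum.\<close>
      have "e i w = e j w"
        by (rule inj_onD[OF bij_betw_imp_inj_on[OF bij] _ e[OF i w(1)] e[OF j w(2)]])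
          (simp add: sum_e[OF i] sum_e[OF j])
      then have "e i w i = e j w i" by simp
      then have "(mon w :: ('n, 'k) mpoly) = 0" using i ij by (simp add: e_def)
      then show False by (metis keys_single keys_zero mon_def insert_not_empty one_neq_zero)
    qed
  qed
qed

section \<open>Matching cones with minimal generators\<close>

lemma cone_vertices_eq_generators:
  fixes I :: "('n, 'k::field) mpoly set"
  assumes gen: "minimal_monomial_generators I A" and "finite A"
    and len: "length ps = card A" and un: "\<Union> (cone ` set ps) = {w. (mon w :: ('n, 'k) mpoly) \<in> I}"
  shows "fst ` set ps = A"
proof -
  have I: "(mon w :: ('n, 'k) mpoly) \<in> I \<longleftrightarrow> (\<exists>b\<in>A. mon_dvd b w)" for w
    using gen mon_in_span_iff[of w A] by (auto simp: minimal_monomial_generators_def)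
  have "A \<subseteq> fst ` set ps"
  proof
    fix a assume a: "a \<in> A"
    then have "a \<in> \<Union> (cone ` set ps)" unfolding un using I by blast
    then obtain p where p: "p \<in> set ps" "a \<in> cone p" by blast
    have "fst p \<in> \<Union> (cone ` set ps)" using p(1) vertex_in_cone by blast
    then obtain b where b: "b \<in> A" "mon_dvd b (fst p)" using un I by blast
    have pa: "mon_dvd (fst p) a" using p(2) by (simp add: cone_iff)
    \<comment> \<open>The vertex \<open>fst p\<close> lies between the generators \<open>b\<close>
      and \<open>a\<close> in the divisibility order, so the antichain property makes all three
      coincide.\<close>
    have "b = a"
      by (rule minimal_monomial_generators_antichain[OF gen b(1) a mon_dvd_trans[OF b(2) pa]])
    then have "a = fst p" using mon_dvd_antisym b(2) pa by blast
    then show "a \<in> fst ` set ps" using p(1) by blast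
  qed
  \<comment> \<open>There are only \<open>card A\<close> cones, so no vertex is left over beyond the
    generators.\<close>
  moreover have "card (fst ` set ps) \<le> card A"
    using card_length[of "map fst ps"] len by simp
  ultimately show ?thesis using card_seteq[of "fst ` set ps" A] by auto
qed

theorem proposition4p2:
  fixes I :: "('n::finite, 'k::field) mpoly set"
    and A :: "('n \<Rightarrow>\<^sub>0 nat) set" and m :: nat
  assumes "monomial_ideal I"
    and "minimal_monomial_generators I A" and "finite A" and "card A = m"
    and "slength (*) multigrade I = enat m" and "m \<le> 3"
  shows "linear_quotients I"
proof -
  define L where "L = (\<lambda>D. enat (length D)) ` {D. stanley_decomposition (*) multigrade I D}"
  have m: "Inf L = enat m" using assms(5) by (simp add: slength_def L_def)
  \<comment> \<open>An infimum over the empty set would be infinite. Since \<open>enat\<close> is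
    well-ordered, the infimum of the nonempty set \<open>L\<close> is attained by an actual
    decomposition.\<close>
  then have "L \<noteq> {}" by (auto simp: Inf_enat_def)
  then have "enat m \<in> L" using wellorder_InfI[of _ L] m by fastforce
  then obtain D where D: "stanley_decomposition (*) multigrade I D" "length D = m"
    by (auto simp: L_def)
  obtain rs where rs: "length rs = length D"
    "\<Union> (cone ` set rs) = {w. (mon w :: ('n, 'k) mpoly) \<in> I}"
    "\<And>i j. i < length rs \<Longrightarrow> j < length rs \<Longrightarrow> i \<noteq> j \<Longrightarrow> cone (rs ! i) \<inter> cone (rs ! j) = {}"
    using stanley_decomposition_cones[OF D(1)] by blast
  have fst_rs: "fst ` set rs = A"
    using cone_vertices_eq_generators[OF assms(2,3) _ rs(2)] rs(1) D(2) assms(4) by simp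
  \<comment> \<open>A list of length \<open>m\<close> whose entries form a set of \<open>m\<close>
    elements has no repetition.\<close>
  have "distinct (map fst rs)"
    using fst_rs rs(1) D(2) assms(4) by (intro card_distinct) simp
  then have inj: "inj_on fst (set rs)" by (simp add: distinct_map)
  have I: "I = ideal.span (mon ` A)"
    using assms(2) by (simp add: minimal_monomial_generators_def)
  have up: "mon_up_closed (\<Union> (cone ` set rs))"
    unfolding mon_up_closed_def rs(2) I mem_Collect_eq mon_in_span_iff using mon_dvd_trans by blast
  have disj: "pairwise (\<lambda>p q. cone p \<inter> cone q = {}) (set rs)"
    using rs(3) unfolding pairwise_def by (metis in_set_conv_nth)
  have "card (set rs) \<le> 3" using card_length[of rs] rs(1) D(2) assms(6) by linarith
  then obtain ps where ps: "set ps = set rs" "distinct ps"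
    "sorted_wrt (\<lambda>p q. \<not> cone_arrow p q) ps"
    using ex_cone_order[OF finite_set _ up disj] by metis
  show ?thesis
    unfolding linear_quotients_def
  proof (intro exI[of _ "map fst ps"] conjI allI impI)
    show "distinct (map fst ps)" using ps(1,2) inj by (simp add: distinct_map)
    show "minimal_monomial_generators I (set (map fst ps))" using assms(2) ps(1) fst_rs by simp
    fix j assume "1 \<le> j \<and> j < length (map fst ps)"
    then have "j < length ps" by simp
    then show "\<exists>V. colon (ideal.span (mon ` set (take j (map fst ps))))
        (mon (map fst ps ! j) :: ('n, 'k) mpoly) = ideal.span (var ` V)"
      using colon_of_cone_order[OF ps(3) up[folded ps(1)]] by blast
  qed
qed

end
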